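(* Let $0<p<1$. For $n\ge0$ let $R(n)=R(G(n),p)$ be the all-terminal reliability of the pseudofractal scale-free web $G(n)$ and let $R_s(n)=R(SG(n),p)$ be the all-terminal reliability of the Sierpinski gasket graph $SG(n)$. Then for every $n>1$, $$R_s(n)>R(n).$$
   Context: All-terminal reliability: for a finite connected graph $G$ and $p\in[0,1]$, suppose each edge of $G$ is independently operational with probability $p$ and failed with probability $1-p$, while vertices never fail. $R(G,p)$ is the probability that any two vertices of $G$ are joined by a path of operational edges, i.e. that the spanning subgraph formed by the operational edges is connected. Pseudofractal scale-free web: $G(0)$ is a triangle. For $n\ge1$, $G(n)$ is obtained from $G(n-1)$ by adding, for every edge of $G(n-1)$, one new vertex joined by new edges to both endpoints of that edge (the old edges are kept). Sierpinski gasket graph: $SG(0)$ is a triangle, whose three vertices are its outmost (corner) vertices. $SG(n+1)$ is made of three copies of $SG(n)$ arranged in a larger triangle: each pair of copies shares exactly one vertex, obtained by identifying a corner of one copy with a corner of the other, the two corners of a given copy used for its two identifications being different; the three remaining unidentified corners (one per copy) are the corners of $SG(n+1)$. Both $G(n)$ and $SG(n)$ have $\frac{3^{n+1}+3}{2}$ vertices and $3^{n+1}$ edges. *)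

theory Defs
  imports "HOL-Probability.Probability"
begin

section \<open>All-terminal reliability\<close>

text \<open>
  A finite simple graph is given by its vertex set and its set of edges, an edge being the
  two-element set of its endpoints.
\<close>

definition edge_connected :: "'a set \<Rightarrow> 'a set set \<Rightarrow> bool" where
  "edge_connected V F \<longleftrightarrow> (\<forall>u\<in>V. \<forall>v\<in>V. (u, v) \<in> {(x, y). {x, y} \<in> F}\<^sup>*)"

text \<open>
  A sample assigns to every edge its status (operational or failed). The \<^const>\<open>False\<close> is only the
  conventional value of \<^const>\<open>Pi_pmf\<close> outside \<^term>\<open>E\<close>.
\<close>

definition reliability :: "'a set \<Rightarrow> 'a set set \<Rightarrow> real \<Rightarrow> real" where
  "reliability V E p =
     measure_pmf.prob (Pi_pmf E False (\<lambda>_. bernoulli_pmf p))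
       {\<omega>. edge_connected V {e \<in> E. \<omega> e}}"


section \<open>The two families of graphs\<close>

text \<open>
  Both families are determined only up to isomorphism, so they are described by predicates
  holding of every graph that arises by the construction, whatever its vertices are.
\<close>

inductive pseudofractal_web :: "nat \<Rightarrow> 'a set \<Rightarrow> 'a set set \<Rightarrow> bool" where
  triangle: "distinct [a, b, c] \<Longrightarrow> pseudofractal_web 0 {a, b, c} {{a, b}, {a, c}, {b, c}}"
| step: "pseudofractal_web n V E \<Longrightarrow> inj_on new E \<Longrightarrow> new ` E \<inter> V = {} \<Longrightarrow>
    pseudofractal_web (Suc n) (V \<union> new ` E) (E \<union> {{u, new e} | u e. e \<in> E \<and> u \<in> e})"

text \<open>
  The last argument is the set of the three corners. In the rule \<open>step\<close> the copies are glued by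
  sharing vertices: \<open>x\<close>, \<open>y\<close>, \<open>z\<close> are the three vertices obtained by identification and
  \<open>a\<close>, \<open>b\<close>, \<open>c\<close> the remaining corners. As corner sets have three elements (lemma
  \<open>card_gasket_corners\<close>), the corners of each copy named in the rule are distinct.
\<close>

inductive sierpinski_gasket :: "nat \<Rightarrow> 'a set \<Rightarrow> 'a set set \<Rightarrow> 'a set \<Rightarrow> bool" where
  triangle: "distinct [a, b, c] \<Longrightarrow>
    sierpinski_gasket 0 {a, b, c} {{a, b}, {a, c}, {b, c}} {a, b, c}"
| step: "sierpinski_gasket n V1 E1 {a, x, y} \<Longrightarrow>
    sierpinski_gasket n V2 E2 {b, x, z} \<Longrightarrow>
    sierpinski_gasket n V3 E3 {c, y, z} \<Longrightarrow>
    V1 \<inter> V2 = {x} \<Longrightarrow> V1 \<inter> V3 = {y} \<Longrightarrow> V2 \<inter> V3 = {z} \<Longrightarrow>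
    sierpinski_gasket (Suc n) (V1 \<union> V2 \<union> V3) (E1 \<union> E2 \<union> E3) {a, b, c}"


section \<open>Well-formedness, sizes and existence\<close>

lemma web_wf:
  assumes "pseudofractal_web n V E"
  shows "finite V \<and> finite E \<and> (\<forall>e\<in>E. e \<subseteq> V \<and> card e = 2)"
  using assms
proof induction
  case (step n V E new)
  have *: "{{u, new e} | u e. e \<in> E \<and> u \<in> e} = (\<Union>e\<in>E. (\<lambda>u. {u, new e}) ` e)"
    by auto
  have "finite e" if "e \<in> E" for e
    using that step.IH by (meson finite_subset)
  then have fin: "finite {{u, new e} | u e. e \<in> E \<and> u \<in> e}"
    unfolding * using step.IH by blast
  have "card {u, new e} = 2" if "e \<in> E" "u \<in> e" for u e
  proof -
    have "u \<noteq> new e" using that step by blast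
    then show ?thesis by simp
  qed
  then show ?case using step.IH fin by blast
qed auto

lemma card_web:
  assumes "pseudofractal_web n V E"
  shows "card E = 3 ^ (n + 1) \<and> 2 * card V = 3 ^ (n + 1) + 3"
  using assms
proof induction
  case (triangle a b c)
  then show ?case by (simp add: doubleton_eq_iff)
next
  case (step n V E new)
  note wf = web_wf[OF step.hyps(1)]
  let ?N = "\<lambda>e. (\<lambda>u. {u, new e}) ` e"
  have out: "new e \<notin> e'" if "e \<in> E" "e' \<in> E" for e e'
    using that wf step.hyps(3) by blast
  have *: "{{u, new e} | u e. e \<in> E \<and> u \<in> e} = (\<Union>e\<in>E. ?N e)"
    by auto
  have fin: "finite e" if "e \<in> E" for e
    using that wf by (meson finite_subset)
  have cN: "card (?N e) = 2" if "e \<in> E" for e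
  proof -
    have "inj_on (\<lambda>u. {u, new e}) e"
      using out[OF that that] by (auto simp: inj_on_def doubleton_eq_iff)
    then show ?thesis using wf that by (simp add: card_image)
  qed
  have disj: "?N e \<inter> ?N e' = {}" if "e \<in> E" "e' \<in> E" "e \<noteq> e'" for e e'
  proof -
    have "new e \<noteq> new e'" using that step.hyps(2) by (auto dest: inj_onD)
    then show ?thesis
      using out[of e e'] out[of e' e] that by (auto simp: doubleton_eq_iff)
  qed
  have "card (\<Union>e\<in>E. ?N e) = (\<Sum>e\<in>E. card (?N e))"
    using disj fin wf by (intro card_UN_disjoint) auto
  also have "\<dots> = 2 * card E" using cN by simp
  finally have c: "card (\<Union>e\<in>E. ?N e) = 2 * card E" .
  have dE: "E \<inter> (\<Union>e\<in>E. ?N e) = {}" using out by blast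
  have "card (E \<union> (\<Union>e\<in>E. ?N e)) = 3 * card E"
    using c dE wf fin by (subst card_Un_disjoint) auto
  moreover have "card (V \<union> new ` E) = card V + card E"
    using wf step.hyps(2,3) by (subst card_Un_disjoint) (auto simp: card_image)
  ultimately show ?case unfolding * using step.IH by simp
qed

lemma web_exists:
  assumes "infinite (UNIV :: 'a set)"
  shows "\<exists>V (E :: 'a set set). pseudofractal_web n V E"
proof (induction n)
  case 0
  obtain A :: "'a set" where "card A = 3"
    using infinite_arbitrarily_large[OF assms] by blast
  then obtain a b c where "A = {a, b, c}" "a \<noteq> b" "b \<noteq> c" "a \<noteq> c"
    using card_3_iff[of A] by blast
  then have "distinct [a, b, c]" by simp
  from pseudofractal_web.triangle[OF this] show ?case by (intro exI)
next
  case (Suc n)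
  then obtain V and E :: "'a set set" where VE: "pseudofractal_web n V E" by blast
  note wf = web_wf[OF VE]
  have "infinite (- V)" using wf assms by (simp add: Compl_eq_Diff_UNIV)
  then obtain B where B: "finite B" "card B = card E" "B \<subseteq> - V"
    using infinite_arbitrarily_large by blast
  then obtain new where "bij_betw new E B"
    using wf finite_same_card_bij by metis
  then have "inj_on new E" "new ` E \<inter> V = {}"
    using B by (auto simp: bij_betw_def)
  then show ?case using pseudofractal_web.step[OF VE] by blast
qed

lemma card_gasket_corners:
  assumes "sierpinski_gasket n V E C"
  shows "C \<subseteq> V \<and> card C = 3"
  using assms
proof induction
  case (step n V1 E1 a x y V2 E2 b z V3 E3 c)
  have d: "a \<noteq> x" "a \<noteq> y" "x \<noteq> y" "b \<noteq> x" "b \<noteq> z" "x \<noteq> z" "c \<noteq> y" "c \<noteq> z" "y \<noteq> z"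
    using step.IH by (auto simp: card_insert_if split: if_splits)
  have V: "a \<in> V1" "b \<in> V2" "c \<in> V3" using step.IH by auto
  have "a \<noteq> b" using V d(1) step.hyps(4) by blast
  moreover have "a \<noteq> c" using V d(2) step.hyps(5) by blast
  moreover have "b \<noteq> c" using V d(5) step.hyps(6) by blast
  ultimately show ?case using V by auto
qed auto

lemma gasket_wf:
  assumes "sierpinski_gasket n V E C"
  shows "finite V \<and> finite E \<and> (\<forall>e\<in>E. e \<subseteq> V \<and> card e = 2)"
  using assms by induction auto

lemma card_gasket:
  assumes "sierpinski_gasket n V E C"
  shows "card E = 3 ^ (n + 1) \<and> 2 * card V = 3 ^ (n + 1) + 3"
  using assms
proof induction
  case (triangle a b c)
  then show ?case by (simp add: doubleton_eq_iff)
next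
  case (step n V1 E1 a x y V2 E2 b z V3 E3 c)
  note wf = gasket_wf[OF step.hyps(1)] gasket_wf[OF step.hyps(2)] gasket_wf[OF step.hyps(3)]
  have d: "x \<noteq> y" "x \<noteq> z" "y \<noteq> z"
    using step.hyps(1-3)[THEN card_gasket_corners]
    by (auto simp: card_insert_if split: if_splits)
  have no: "\<not> e \<subseteq> {v}" if "card e = 2" for e and v :: 'a
    using that card_mono[of "{v}" e] by auto
  have E12: "E1 \<inter> E2 = {}" and E13: "E1 \<inter> E3 = {}" and E23: "E2 \<inter> E3 = {}"
    using wf no step.hyps(4-6) by (metis disjoint_iff le_inf_iff)+
  have "card (E1 \<union> E2 \<union> E3) = card E1 + card E2 + card E3"
    using wf E12 E13 E23 by (simp add: card_Un_disjoint Int_Un_distrib2)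
  moreover have "card (V1 \<union> V2) + 1 = card V1 + card V2"
    using card_Un_Int[of V1 V2] wf step.hyps(4) by simp
  moreover have "card (V1 \<union> V2 \<union> V3) + 2 = card (V1 \<union> V2) + card V3"
  proof -
    have "(V1 \<union> V2) \<inter> V3 = {y, z}" using step.hyps(5,6) by blast
    then show ?thesis using card_Un_Int[of "V1 \<union> V2" V3] wf d by simp
  qed
  ultimately show ?case using step.IH by simp
qed

lemma gasket_image:
  assumes "sierpinski_gasket n V E C" "inj f"
  shows "sierpinski_gasket n (f ` V) ((`) f ` E) (f ` C)"
  using assms
proof induction
  case (triangle a b c)
  then have "distinct [f a, f b, f c]" by (auto dest: injD)
  from sierpinski_gasket.triangle[OF this] show ?case by simp
next
  case (step n V1 E1 a x y V2 E2 b z V3 E3 c)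
  have "f ` V1 \<inter> f ` V2 = {f x}" "f ` V1 \<inter> f ` V3 = {f y}" "f ` V2 \<inter> f ` V3 = {f z}"
    using step.hyps(4-6) step.prems by (simp_all flip: image_Int)
  from sierpinski_gasket.step[OF _ _ _ this] show ?case
    using step.IH step.prems by (simp add: image_Un)
qed

text \<open>The usual picture of the gasket: translated copies in the plane, in lattice coordinates.\<close>

lemma gasket_exists_lattice:
  "\<exists>V E. sierpinski_gasket n V E {(0, 0), (2 ^ n, 0), (0, 2 ^ n)} \<and>
     V \<subseteq> {(i, j :: nat). i + j \<le> 2 ^ n}"
proof (induction n)
  case 0
  have "distinct [(0, 0), (2 ^ 0, 0), (0, 2 ^ 0) :: nat \<times> nat]" by simp
  from sierpinski_gasket.triangle[OF this] show ?case
    by (intro exI conjI) auto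
next
  case (Suc n)
  then obtain V and E :: "(nat \<times> nat) set set"
    where VE: "sierpinski_gasket n V E {(0, 0), (2 ^ n, 0), (0, 2 ^ n)}"
      and V: "V \<subseteq> {(i, j). i + j \<le> 2 ^ n}" by blast
  define f g :: "nat \<times> nat \<Rightarrow> nat \<times> nat"
    where "f = (\<lambda>(i, j). (i + 2 ^ n, j))" and "g = (\<lambda>(i, j). (i, j + 2 ^ n))"
  have inj: "inj f" "inj g" by (auto simp: f_def g_def inj_def)
  have C: "{(0, 0), (2 ^ n, 0), (0, 2 ^ n)} \<subseteq> V"
    using card_gasket_corners[OF VE] by blast
  have 1: "sierpinski_gasket n (f ` V) ((`) f ` E) {(2 ^ Suc n, 0), (2 ^ n, 0), (2 ^ n, 2 ^ n)}"
    using gasket_image[OF VE inj(1)] by (simp add: f_def insert_commute mult_2)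
  have 2: "sierpinski_gasket n (g ` V) ((`) g ` E) {(0, 2 ^ Suc n), (0, 2 ^ n), (2 ^ n, 2 ^ n)}"
    using gasket_image[OF VE inj(2)] by (simp add: g_def insert_commute mult_2)
  have fg: "f ` V \<subseteq> {(i, j). i + j \<le> 2 ^ Suc n \<and> 2 ^ n \<le> i}"
    "g ` V \<subseteq> {(i, j). i + j \<le> 2 ^ Suc n \<and> 2 ^ n \<le> j}"
    using V by (auto simp: f_def g_def)
  have mem: "(2 ^ n, 0) \<in> f ` V" "(2 ^ n, 2 ^ n) \<in> f ` V" "(0, 2 ^ n) \<in> g ` V" "(2 ^ n, 2 ^ n) \<in> g ` V"
    using 1 2 card_gasket_corners by blast+
  have i1: "V \<inter> f ` V = {(2 ^ n, 0)}"
  proof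
    show "V \<inter> f ` V \<subseteq> {(2 ^ n, 0)}"
      using subsetD[OF V] subsetD[OF fg(1)] by fastforce
  qed (use C mem in auto)
  have i2: "V \<inter> g ` V = {(0, 2 ^ n)}"
  proof
    show "V \<inter> g ` V \<subseteq> {(0, 2 ^ n)}"
      using subsetD[OF V] subsetD[OF fg(2)] by fastforce
  qed (use C mem in auto)
  have i3: "f ` V \<inter> g ` V = {(2 ^ n, 2 ^ n)}"
  proof
    show "f ` V \<inter> g ` V \<subseteq> {(2 ^ n, 2 ^ n)}"
      using subsetD[OF fg(1)] subsetD[OF fg(2)] by fastforce
  qed (use mem in auto)
  have "sierpinski_gasket (Suc n) (V \<union> f ` V \<union> g ` V) (E \<union> (`) f ` E \<union> (`) g ` E)
      {(0, 0), (2 ^ Suc n, 0), (0, 2 ^ Suc n)}"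
    by (rule sierpinski_gasket.step[OF VE 1 2 i1 i2 i3])
  moreover have "V \<union> f ` V \<union> g ` V \<subseteq> {(i, j). i + j \<le> 2 ^ Suc n}"
    using V fg by auto
  ultimately show ?case by blast
qed

lemma gasket_exists:
  assumes "infinite (UNIV :: 'a set)"
  shows "\<exists>V (E :: 'a set set) C. sierpinski_gasket n V E C"
proof -
  obtain h :: "nat \<Rightarrow> 'a" where "inj h"
    using assms by (auto simp: infinite_iff_countable_subset)
  then have "inj (h \<circ> (to_nat :: nat \<times> nat \<Rightarrow> nat))"
    by (intro inj_compose) auto
  then show ?thesis using gasket_exists_lattice gasket_image by metis
qed

end

theory Submission
  imports Defs
begin

text \<open>
  Both graphs of stage \<open>n + 1\<close> consist of three copies of stage \<open>n\<close> glued pairwise at three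
  vertices \<open>x\<close>, \<open>y\<close>, \<open>z\<close>; they differ only in the choice of the new corners, which for the web are
  \<open>x\<close>, \<open>y\<close>, \<open>z\<close> themselves. Let \<open>r\<close> be the reliability and \<open>i\<close> the probability that there are
  exactly two components, one containing a given corner and the other one the remaining two. In
  both cases the gluing gives \<open>r' = r^3 + 6 r^2 i\<close>, because at most one copy may be disconnected, and
  then only by separating its two glued corners. For the web, isolating \<open>x\<close> forces both copies
  at \<open>x\<close> to split, so \<open>i' = 4 r i^2\<close>. In the gasket it suffices that the isolated corner is
  isolated within its own copy, while at most one of the other two copies splits, so
  \<open>i' \<ge> i (r^2 + 4 r i) > 4 r i^2\<close>. Hence the gasket has the larger \<open>i\<close> from stage 1 on and the
  larger \<open>r\<close> from stage 2 on.
\<close>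

section \<open>Probabilities of events on edge sets\<close>

text \<open>A finite sum over sets of operational edges replaces the product measure: independence
  becomes multiplication of sums, and no default value outside \<open>E\<close> occurs.\<close>

definition weight :: "real \<Rightarrow> 'e set \<Rightarrow> ('e set \<Rightarrow> bool) \<Rightarrow> real" where
  "weight p E P = (\<Sum>F | F \<subseteq> E \<and> P F. \<Prod>e\<in>E. if e \<in> F then p else 1 - p)"

text \<open>Only samples that are \<open>False\<close> outside \<open>E\<close> have positive mass,
  and these are the indicators of the subsets of \<open>E\<close>.\<close>

lemma prob_Pi_bernoulli_eq_weight:
  assumes "finite E" "0 < p" "p < 1"
  shows "measure_pmf.prob (Pi_pmf E False (\<lambda>_. bernoulli_pmf p)) {\<omega>. P {e \<in> E. \<omega> e}} = weight p E P"
proof -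
  let ?M = "Pi_pmf E False (\<lambda>_. bernoulli_pmf p)"
  let ?g = "\<lambda>F e. e \<in> F"
  let ?I = "?g ` {F. F \<subseteq> E \<and> P F}"
  have fin: "finite {F. F \<subseteq> E \<and> P F}" using assms(1) by simp
  \<comment> \<open>The two events differ only in samples that are \<open>True\<close> somewhere
    outside \<open>E\<close>, which have mass 0.\<close>
  have "measure_pmf.prob ?M {\<omega>. P {e \<in> E. \<omega> e}} = measure_pmf.prob ?M ?I"
  proof (rule measure_prob_cong_0)
    fix \<omega> assume \<omega>: "\<omega> \<in> {\<omega>. P {e \<in> E. \<omega> e}} - ?I"
    have "\<not> (\<forall>e. e \<notin> E \<longrightarrow> \<omega> e = False)"
    proof
      assume "\<forall>e. e \<notin> E \<longrightarrow> \<omega> e = False"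
      then have "\<omega> = ?g {e \<in> E. \<omega> e}" by auto
      then have "\<omega> \<in> ?I" using \<omega> by blast
      then show False using \<omega> by blast
    qed
    then show "pmf ?M \<omega> = 0" using assms(1) by (auto simp: pmf_Pi)
  next
    fix \<omega> assume "\<omega> \<in> ?I - {\<omega>. P {e \<in> E. \<omega> e}}"
    then obtain F where "F \<subseteq> E" "P F" "\<omega> = ?g F" "\<not> P {e \<in> E. e \<in> F}" by blast
    moreover from this have "{e \<in> E. e \<in> F} = F" by blast
    ultimately show "pmf ?M \<omega> = 0" by simp
  qed
  also have "\<dots> = (\<Sum>\<omega>\<in>?I. pmf ?M \<omega>)"
    using fin by (intro measure_measure_pmf_finite) simp
  also have "\<dots> = (\<Sum>F | F \<subseteq> E \<and> P F. pmf ?M (?g F))"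
    by (subst sum.reindex) (auto simp: inj_on_def fun_eq_iff)
  also have "\<dots> = weight p E P"
    unfolding weight_def
  proof (rule sum.cong[OF refl])
    fix F assume "F \<in> {F. F \<subseteq> E \<and> P F}"
    then have "pmf ?M (?g F) = (\<Prod>e\<in>E. pmf (bernoulli_pmf p) (e \<in> F))"
      by (subst pmf_Pi[OF assms(1)]) auto
    also have "\<dots> = (\<Prod>e\<in>E. if e \<in> F then p else 1 - p)"
      using assms by (intro prod.cong) auto
    finally show "pmf ?M (?g F) = (\<Prod>e\<in>E. if e \<in> F then p else 1 - p)" .
  qed
  finally show ?thesis .
qed

section \<open>Order, additivity and independence of \<open>weight\<close>\<close>

lemma weight_nonneg:
  assumes "0 < p" "p < 1"
  shows "0 \<le> weight p E P"
  unfolding weight_def using assms by (intro sum_nonneg prod_nonneg) auto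

lemma weight_mono:
  assumes "finite E" "0 < p" "p < 1" "\<And>F. F \<subseteq> E \<Longrightarrow> P F \<Longrightarrow> Q F"
  shows "weight p E P \<le> weight p E Q"
  unfolding weight_def using assms by (intro sum_mono2 prod_nonneg) auto

lemma weight_cong:
  assumes "\<And>F. F \<subseteq> E \<Longrightarrow> P F \<longleftrightarrow> Q F"
  shows "weight p E P = weight p E Q"
  unfolding weight_def using assms by (intro sum.cong) auto

lemma weight_disj:
  assumes "finite E" "\<And>F. F \<subseteq> E \<Longrightarrow> \<not> (P F \<and> Q F)"
  shows "weight p E (\<lambda>F. P F \<or> Q F) = weight p E P + weight p E Q"
proof -
  have "{F. F \<subseteq> E \<and> (P F \<or> Q F)} = {F. F \<subseteq> E \<and> P F} \<union> {F. F \<subseteq> E \<and> Q F}" by auto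
  then show ?thesis
    unfolding weight_def using assms by (simp, subst sum.union_disjoint) auto
qed

text \<open>A subset of the disjoint union corresponds to its pair of traces on \<open>E\<close> and
  \<open>E'\<close>, and the product of edge factors splits accordingly.\<close>

lemma weight_indep:
  assumes "finite E" "finite E'" "E \<inter> E' = {}"
  shows "weight p (E \<union> E') (\<lambda>F. P (F \<inter> E) \<and> Q (F \<inter> E')) = weight p E P * weight p E' Q"
proof -
  let ?w = "\<lambda>F e. if e \<in> F then p else 1 - p"
  have "weight p E P * weight p E' Q =
      (\<Sum>(A, B) \<in> {F. F \<subseteq> E \<and> P F} \<times> {F. F \<subseteq> E' \<and> Q F}. prod (?w A) E * prod (?w B) E')"
    by (simp add: weight_def sum_product sum.cartesian_product)
  also have "\<dots> = weight p (E \<union> E') (\<lambda>F. P (F \<inter> E) \<and> Q (F \<inter> E'))"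
    unfolding weight_def
  proof (rule sum.reindex_bij_witness[where i = "\<lambda>F. (F \<inter> E, F \<inter> E')" and j = "\<lambda>(A, B). A \<union> B"],
      goal_cases)
    case (1 a)
    then show ?case using assms(3) by auto
  next
    case (2 a)
    then obtain A B where a: "a = (A, B)" "A \<subseteq> E" "P A" "B \<subseteq> E'" "Q B" by auto
    moreover have "(A \<union> B) \<inter> E = A" "(A \<union> B) \<inter> E' = B" using a assms(3) by auto
    ultimately show ?case by auto
  next
    case (3 F)
    then show ?case by auto
  next
    case (4 F)
    then show ?case by auto
  next
    case (5 a)
    then obtain A B where a: "a = (A, B)" "A \<subseteq> E" "B \<subseteq> E'" by auto
    have "prod (?w (A \<union> B)) (E \<union> E') = prod (?w (A \<union> B)) E * prod (?w (A \<union> B)) E'"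
      using assms by (rule prod.union_disjoint)
    also have "prod (?w (A \<union> B)) E = prod (?w A) E"
      using a assms(3) by (intro prod.cong) auto
    also have "prod (?w (A \<union> B)) E' = prod (?w B) E'"
      using a assms(3) by (intro prod.cong) auto
    finally show ?case using a by simp
  qed
  finally show ?thesis by simp
qed

lemma weight_indep3:
  assumes "finite E1" "finite E2" "finite E3" "E1 \<inter> E2 = {}" "E1 \<inter> E3 = {}" "E2 \<inter> E3 = {}"
  shows "weight p (E1 \<union> E2 \<union> E3) (\<lambda>F. P1 (F \<inter> E1) \<and> P2 (F \<inter> E2) \<and> P3 (F \<inter> E3)) =
    weight p E1 P1 * weight p E2 P2 * weight p E3 P3"
proof -
  have "weight p (E1 \<union> E2 \<union> E3) (\<lambda>F. P1 (F \<inter> E1) \<and> P2 (F \<inter> E2) \<and> P3 (F \<inter> E3)) =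
    weight p ((E1 \<union> E2) \<union> E3)
      (\<lambda>F. (P1 (F \<inter> (E1 \<union> E2) \<inter> E1) \<and> P2 (F \<inter> (E1 \<union> E2) \<inter> E2)) \<and> P3 (F \<inter> E3))"
    by (intro weight_cong) (simp add: Int_assoc Int_absorb1)
  also have "\<dots> = weight p (E1 \<union> E2) (\<lambda>F. P1 (F \<inter> E1) \<and> P2 (F \<inter> E2)) * weight p E3 P3"
    using assms by (subst weight_indep) auto
  also have "\<dots> = weight p E1 P1 * weight p E2 P2 * weight p E3 P3"
    using assms by (subst weight_indep) auto
  finally show ?thesis .
qed


section \<open>Reachability\<close>

definition joined :: "'a set set \<Rightarrow> 'a \<Rightarrow> 'a \<Rightarrow> bool" where
  "joined F u v \<longleftrightarrow> (u, v) \<in> {(x, y). {x, y} \<in> F}\<^sup>*"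

text \<open>For edges within \<open>V\<close> this means exactly two components, one containing
  \<open>x\<close> and the other \<open>y\<close>. It is the only way in which a copy may be
  disconnected while the glued graph is connected.\<close>

definition split_by :: "'a set \<Rightarrow> 'a \<Rightarrow> 'a \<Rightarrow> 'a set set \<Rightarrow> bool" where
  "split_by V x y F \<longleftrightarrow> \<not> joined F x y \<and> (\<forall>v\<in>V. joined F x v \<or> joined F y v)"

text \<open>Exactly two components, one containing \<open>u\<close> and the other one both \<open>v\<close> and \<open>w\<close>.\<close>

definition isolates :: "'a set \<Rightarrow> 'a \<Rightarrow> 'a \<Rightarrow> 'a \<Rightarrow> 'a set set \<Rightarrow> bool" where
  "isolates V u v w F \<longleftrightarrow> split_by V u v F \<and> joined F v w"

lemma edge_connected_iff: "edge_connected V F \<longleftrightarrow> (\<forall>u\<in>V. \<forall>v\<in>V. joined F u v)"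
  by (simp add: edge_connected_def joined_def)

lemma joined_refl [simp]: "joined F u u"
  by (simp add: joined_def)

lemma joined_sym: "joined F u v \<Longrightarrow> joined F v u"
proof -
  assume "joined F u v"
  moreover have "sym ({(x, y). {x, y} \<in> F}\<^sup>*)"
    by (intro sym_rtrancl) (auto simp: sym_def insert_commute)
  ultimately show ?thesis unfolding joined_def by (meson symD)
qed

lemma joined_trans: "joined F u v \<Longrightarrow> joined F v w \<Longrightarrow> joined F u w"
  unfolding joined_def by simp

lemma joined_step: "joined F u v \<Longrightarrow> {v, w} \<in> F \<Longrightarrow> joined F u w"
  unfolding joined_def by (rule rtrancl.rtrancl_into_rtrancl) auto

lemma joined_step_left: "joined F u v \<Longrightarrow> {u, w} \<in> F \<Longrightarrow> joined F w v"
  using joined_step joined_sym by metis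

lemma joined_mono: "joined F u v \<Longrightarrow> F \<subseteq> F' \<Longrightarrow> joined F' u v"
  unfolding joined_def by (erule rev_subsetD, intro rtrancl_mono) auto

text \<open>The tool for excluding paths: a set closed under the edges of \<open>F\<close> cannot be
  left.\<close>

lemma joined_closed:
  assumes "joined F u v" "u \<in> K" "\<And>k l. k \<in> K \<Longrightarrow> {k, l} \<in> F \<Longrightarrow> l \<in> K"
  shows "v \<in> K"
  using assms(1,2) unfolding joined_def
  by (induction rule: rtrancl_induct) (auto intro: assms(3))

lemma edge_connectedI:
  assumes "\<And>v. v \<in> V \<Longrightarrow> joined F x v"
  shows "edge_connected V F"
  using assms joined_sym joined_trans unfolding edge_connected_iff by metis

lemma split_by_cases:
  assumes "a \<in> V"
  shows "split_by V x y F \<longleftrightarrow> isolates V x y a F \<or> isolates V y x a F"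
  using assms joined_sym unfolding split_by_def isolates_def by metis

lemma isolates_exclusive: "\<not> (isolates V x y a F \<and> isolates V y x a F)"
  unfolding isolates_def split_by_def by (meson joined_sym joined_trans)

text \<open>The third corner \<open>a\<close> lies in exactly one of the two components, which gives
  two exclusive cases. This is the source of the factor 2 in the bounds for
  \<open>split_by\<close>.\<close>

lemma weight_split_by:
  assumes "finite E" "a \<in> V"
  shows "weight p E (split_by V x y) =
    weight p E (isolates V x y a) + weight p E (isolates V y x a)"
proof -
  have "weight p E (split_by V x y) = weight p E (\<lambda>F. isolates V x y a F \<or> isolates V y x a F)"
    using split_by_cases[OF assms(2)] by (intro weight_cong) auto
  then show ?thesis
    using weight_disj[OF assms(1)] isolates_exclusive by metis
qed


section \<open>Three copies glued in a cycle\<close>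

text \<open>The copies form a ring: 1 and 2 meet in \<open>x\<close>, 1 and 3 in \<open>y\<close>, 2
  and 3 in \<open>z\<close>. Outer corners are left out, so that both families fit, and the edge
  sets may be arbitrary, so that operational subgraphs fit too.\<close>

definition glued where
  "glued V1 V2 V3 E1 E2 E3 x y z \<longleftrightarrow>
     V1 \<inter> V2 = {x} \<and> V1 \<inter> V3 = {y} \<and> V2 \<inter> V3 = {z} \<and> x \<noteq> y \<and> x \<noteq> z \<and> y \<noteq> z \<and>
     \<Union>E1 \<subseteq> V1 \<and> \<Union>E2 \<subseteq> V2 \<and> \<Union>E3 \<subseteq> V3 \<and>
     finite E1 \<and> finite E2 \<and> finite E3 \<and> E1 \<inter> E2 = {} \<and> E1 \<inter> E3 = {} \<and> E2 \<inter> E3 = {}"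

text \<open>Together with \<open>glued_swap23\<close> this generates all six relabellings of the
  ring, so each fact below is proved for one position only.\<close>

lemma glued_swap12: "glued V1 V2 V3 E1 E2 E3 x y z \<Longrightarrow> glued V2 V1 V3 E2 E1 E3 x z y"
  unfolding glued_def by blast

lemma glued_swap23: "glued V1 V2 V3 E1 E2 E3 x y z \<Longrightarrow> glued V1 V3 V2 E1 E3 E2 y x z"
  unfolding glued_def by blast

lemma glued_edges:
  assumes "glued V1 V2 V3 E1 E2 E3 x y z"
  shows "finite E1" "finite E2" "finite E3" "E1 \<inter> E2 = {}" "E1 \<inter> E3 = {}" "E2 \<inter> E3 = {}"
  using assms unfolding glued_def by auto

lemma glued_joints:
  assumes "glued V1 V2 V3 E1 E2 E3 x y z"
  shows "x \<in> V1" "x \<in> V2" "y \<in> V1" "y \<in> V3" "z \<in> V2" "z \<in> V3"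
  using assms unfolding glued_def by auto

text \<open>Transfers facts about fixed edge sets to a random edge set \<open>F\<close> by way of
  its three traces.\<close>

lemma glued_Int:
  assumes g: "glued V1 V2 V3 E1 E2 E3 x y z" and F: "F \<subseteq> E1 \<union> E2 \<union> E3"
  shows "glued V1 V2 V3 (F \<inter> E1) (F \<inter> E2) (F \<inter> E3) x y z"
    and "F \<inter> E1 \<union> F \<inter> E2 \<union> F \<inter> E3 = F"
proof -
  have "\<Union>(F \<inter> E1) \<subseteq> V1" "\<Union>(F \<inter> E2) \<subseteq> V2" "\<Union>(F \<inter> E3) \<subseteq> V3"
    using g unfolding glued_def by blast+
  moreover have "F \<inter> E1 \<inter> (F \<inter> E2) = {}" "F \<inter> E1 \<inter> (F \<inter> E3) = {}" "F \<inter> E2 \<inter> (F \<inter> E3) = {}"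
    using glued_edges[OF g] by blast+
  ultimately show "glued V1 V2 V3 (F \<inter> E1) (F \<inter> E2) (F \<inter> E3) x y z"
    using g unfolding glued_def by simp
  show "F \<inter> E1 \<union> F \<inter> E2 \<union> F \<inter> E3 = F" using F by blast
qed

text \<open>A path that enters the first copy from outside does so through \<open>x\<close> or \<open>y\<close>.\<close>

lemma glued_exit:
  assumes g: "glued V1 V2 V3 F1 F2 F3 x y z"
    and "v \<in> V1" "joined (F1 \<union> F2 \<union> F3) t v" "t \<in> V1 \<Longrightarrow> t \<in> {x, y}"
  shows "joined F1 x v \<or> joined F1 y v"
proof (rule ccontr)
  assume n: "\<not> ?thesis"
  \<comment> \<open>Walking back from \<open>v\<close>, this set could be left only at
    \<open>x\<close> or \<open>y\<close>, which \<open>n\<close> keeps out of it; hence it would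
    contain \<open>t\<close>.\<close>
  let ?K = "{w \<in> V1. joined F1 w v}"
  have V12: "w = x" if "w \<in> V1" "w \<in> V2" for w using that g unfolding glued_def by blast
  have V13: "w = y" if "w \<in> V1" "w \<in> V3" for w using that g unfolding glued_def by blast
  have sub: "l \<in> V1" if "{k, l} \<in> F1" for k l using that g unfolding glued_def by blast
  have sub2: "k \<in> V2" if "{k, l} \<in> F2" for k l using that g unfolding glued_def by blast
  have sub3: "k \<in> V3" if "{k, l} \<in> F3" for k l using that g unfolding glued_def by blast
  have "t \<in> ?K"
    using joined_sym[OF assms(3)]
  proof (rule joined_closed)
    fix k l assume k: "k \<in> ?K" and e: "{k, l} \<in> F1 \<union> F2 \<union> F3"
    have "k \<noteq> x \<and> k \<noteq> y" using k n by auto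
    then have "k \<notin> V2 \<and> k \<notin> V3" using k V12 V13 by auto
    then have kl: "{k, l} \<in> F1" using e sub2 sub3 by auto
    then have "joined F1 l v" using k joined_step_left[of F1 k v l] by simp
    then show "l \<in> ?K" using kl sub by simp
  qed (use assms in simp)
  then show False using assms(4) n by auto
qed

text \<open>All edges at \<open>x\<close> lie in the first two copies. What \<open>x\<close> reaches
  inside them avoids \<open>y\<close> and \<open>z\<close>, so it never enters the third
  copy.\<close>

lemma glued_two_cuts:
  assumes g: "glued V1 V2 V3 F1 F2 F3 x y z"
    and n: "\<not> joined F1 x y" "\<not> joined F2 x z"
  shows "\<not> joined (F1 \<union> F2 \<union> F3) x y"
proof
  let ?K = "{w \<in> V1. joined F1 x w} \<union> {w \<in> V2. joined F2 x w}"
  have V12: "w = x" if "w \<in> V1" "w \<in> V2" for w using that g unfolding glued_def by blast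
  have V13: "w = y" if "w \<in> V1" "w \<in> V3" for w using that g unfolding glued_def by blast
  have V23: "w = z" if "w \<in> V2" "w \<in> V3" for w using that g unfolding glued_def by blast
  have sub: "l \<in> V1 \<and> k \<in> V1" if "{k, l} \<in> F1" for k l using that g unfolding glued_def by blast
  have sub2: "l \<in> V2 \<and> k \<in> V2" if "{k, l} \<in> F2" for k l using that g unfolding glued_def by blast
  have sub3: "k \<in> V3" if "{k, l} \<in> F3" for k l using that g unfolding glued_def by blast
  have x: "x \<in> V1" and y: "y \<in> V1" "x \<noteq> y" using g unfolding glued_def by auto
  assume "joined (F1 \<union> F2 \<union> F3) x y"
  then have "y \<in> ?K"
  proof (rule joined_closed)
    fix k l assume k: "k \<in> ?K" and e: "{k, l} \<in> F1 \<union> F2 \<union> F3"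
    have "k \<notin> V3" using k n V13 V23 by auto
    then consider "{k, l} \<in> F1" | "{k, l} \<in> F2"
      using e sub3 by blast
    then show "l \<in> ?K"
    proof cases
      case 1
      \<comment> \<open>A member of \<open>?K\<close> coming from the second copy and incident with
        an edge of \<open>F1\<close> lies in both copies, so it is \<open>x\<close>.\<close>
      then have "joined F1 x k" using k sub[of k l] V12[of k] by auto
      then show ?thesis using 1 sub joined_step by fast
    next
      case 2
      then have "joined F2 x k" using k sub2[of k l] V12[of k] by auto
      then show ?thesis using 2 sub2 joined_step by fast
    qed
  qed (use x in simp)
  then show False using n y V12 by auto
qed

section \<open>Connectedness and isolation in a ring of three copies\<close>

lemma split_or_connected:
  assumes "\<And>v. v \<in> V \<Longrightarrow> joined F x v \<or> joined F y v"
  shows "split_by V x y F \<or> edge_connected V F"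
proof (cases "joined F x y")
  case True
  then show ?thesis using assms joined_trans edge_connectedI by metis
next
  case False
  then show ?thesis using assms by (simp add: split_by_def)
qed

text \<open>Paths enter a copy through its two joints, so each copy is connected or split between
  them. Two split copies would cut off the joint they share; a single split copy is bypassed through
  the other two.\<close>

lemma glued_connected_iff:
  assumes g: "glued V1 V2 V3 F1 F2 F3 x y z"
  shows "edge_connected (V1 \<union> V2 \<union> V3) (F1 \<union> F2 \<union> F3) \<longleftrightarrow>
    edge_connected V1 F1 \<and> edge_connected V2 F2 \<and> edge_connected V3 F3 \<or>
    split_by V1 x y F1 \<and> edge_connected V2 F2 \<and> edge_connected V3 F3 \<or>
    edge_connected V1 F1 \<and> split_by V2 x z F2 \<and> edge_connected V3 F3 \<or>
    edge_connected V1 F1 \<and> edge_connected V2 F2 \<and> split_by V3 y z F3"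
    (is "?L \<longleftrightarrow> ?R")
proof
  let ?F = "F1 \<union> F2 \<union> F3"
  assume L: ?L
  note in_V = glued_joints[OF g]
  have *: "F2 \<union> F1 \<union> F3 = ?F" "F3 \<union> F1 \<union> F2 = ?F" "F1 \<union> F3 \<union> F2 = ?F" "F3 \<union> F2 \<union> F1 = ?F" by auto
  have "joined F1 x v \<or> joined F1 y v" if "v \<in> V1" for v
    using L that in_V by (intro glued_exit[OF g, of v x]) (auto simp: edge_connected_iff)
  then have 1: "split_by V1 x y F1 \<or> edge_connected V1 F1"
    using split_or_connected[of V1 F1 x y] by auto
  have "joined F2 x v \<or> joined F2 z v" if "v \<in> V2" for v
    using L that in_V
    by (intro glued_exit[OF glued_swap12[OF g], of v x]) (auto simp: * edge_connected_iff)
  then have 2: "split_by V2 x z F2 \<or> edge_connected V2 F2"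
    using split_or_connected[of V2 F2 x z] by auto
  have "joined F3 y v \<or> joined F3 z v" if "v \<in> V3" for v
    using L that in_V
    by (intro glued_exit[OF glued_swap12[OF glued_swap23[OF g]], of v y])
      (auto simp: * edge_connected_iff)
  then have 3: "split_by V3 y z F3 \<or> edge_connected V3 F3"
    using split_or_connected[of V3 F3 y z] by auto
  have j: "joined ?F x y" "joined ?F y x" "joined ?F z x" using L in_V by (auto simp: edge_connected_iff)
  \<comment> \<open>Here and in the next two facts, one pair of copies at a time is shown not to be
    split simultaneously.\<close>
  have "joined F1 x y \<or> joined F2 x z"
    using glued_two_cuts[OF g] j by blast
  moreover have "joined F1 x y \<or> joined F3 y z"
    using glued_two_cuts[OF glued_swap23[OF g]] j joined_sym unfolding * by metis
  moreover have "joined F2 x z \<or> joined F3 y z"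
    using glued_two_cuts[OF glued_swap23[OF glued_swap12[OF g]]] j joined_sym
    by (metis * sup_commute sup_assoc)
  ultimately show ?R using 1 2 3 unfolding split_by_def by blast
next
  let ?F = "F1 \<union> F2 \<union> F3"
  assume R: ?R
  note in_V = glued_joints[OF g]
  have m: "joined ?F u v" if "joined F1 u v \<or> joined F2 u v \<or> joined F3 u v" for u v
    using that joined_mono[of _ u v ?F] by blast
  \<comment> \<open>At most one of the three arcs between joints is broken, and the other two go
    around it.\<close>
  have xy: "joined ?F x y" and xz: "joined ?F x z"
    using R in_V m unfolding edge_connected_iff by (meson joined_trans joined_sym)+
  have "joined ?F x v \<or> joined ?F y v \<or> joined ?F z v" if "v \<in> V1 \<union> V2 \<union> V3" for v
    using R in_V m that unfolding edge_connected_iff split_by_def by (meson UnE)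
  then have "joined ?F x v" if "v \<in> V1 \<union> V2 \<union> V3" for v
    using that xy xz joined_trans[of ?F x] by blast
  then show ?L by (metis edge_connectedI)
qed

text \<open>Inside the first copy \<open>x\<close> and \<open>y\<close> remain joined, so the ring
  survives one split among the other two copies, while \<open>a\<close> could escape only through
  \<open>x\<close> or \<open>y\<close>. The condition is only sufficient, as suits a lower bound for
  the gasket.\<close>

lemma glued_isolates_corner:
  assumes g: "glued V1 V2 V3 F1 F2 F3 x y z"
    and "a \<in> V1" "b \<in> V2" "c \<in> V3" "isolates V1 a x y F1"
    and h: "edge_connected V2 F2 \<and> edge_connected V3 F3 \<or>
      split_by V2 x z F2 \<and> edge_connected V3 F3 \<or>
      edge_connected V2 F2 \<and> split_by V3 y z F3"
  shows "isolates (V1 \<union> V2 \<union> V3) a b c (F1 \<union> F2 \<union> F3)"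
proof -
  let ?F = "F1 \<union> F2 \<union> F3"
  note in_V = glued_joints[OF g]
  have m: "joined ?F u v" if "joined F1 u v \<or> joined F2 u v \<or> joined F3 u v" for u v
    using that joined_mono[of _ u v ?F] by blast
  have i: "\<not> joined F1 a x" "\<not> joined F1 a y" "joined F1 x y"
    "\<And>v. v \<in> V1 \<Longrightarrow> joined F1 a v \<or> joined F1 x v"
    using assms(5) unfolding isolates_def split_by_def by (meson joined_sym joined_trans)+
  have xy: "joined ?F x y" using i m by blast
  have xz: "joined ?F x z"
    using h xy in_V m unfolding edge_connected_iff by (meson joined_trans joined_sym)
  have "joined ?F x v \<or> joined ?F y v \<or> joined ?F z v" if "v \<in> V2 \<union> V3" for v
    using h in_V m that unfolding edge_connected_iff split_by_def by (meson UnE)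
  then have x23: "joined ?F x v" if "v \<in> V2 \<union> V3" for v
    using that xy xz joined_trans by metis
  \<comment> \<open>\<open>glued_exit\<close> is used for a path from \<open>x\<close> to
    \<open>a\<close>: some joint of the first copy would reach \<open>a\<close> inside that
    copy.\<close>
  have ax: "\<not> joined ?F a x"
    using glued_exit[OF g assms(2), of x] i joined_sym[of _ a x] joined_sym[of _ x a] joined_sym[of _ y a] by auto
  have "joined ?F a v \<or> joined ?F x v" if "v \<in> V1 \<union> V2 \<union> V3" for v
    using that i(4) m x23 by blast
  then have "joined ?F a v \<or> joined ?F b v" if "v \<in> V1 \<union> V2 \<union> V3" for v
    using that x23[of b] assms(3) joined_trans joined_sym by (metis UnI1)
  moreover have "\<not> joined ?F a b" "joined ?F b c"
    using ax x23[of b] x23[of c] assms(3,4) by (meson UnI1 UnI2 joined_trans joined_sym)+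
  ultimately show ?thesis unfolding isolates_def split_by_def by blast
qed

text \<open>The joint \<open>x\<close> belongs to two copies and must be separated in both of them.
  Then \<open>y\<close> and \<open>z\<close> can be joined only through the third copy.\<close>

lemma glued_isolates_joint:
  assumes g: "glued V1 V2 V3 F1 F2 F3 x y z"
    and i: "isolates (V1 \<union> V2 \<union> V3) x y z (F1 \<union> F2 \<union> F3)"
  shows "split_by V1 x y F1 \<and> split_by V2 x z F2 \<and> edge_connected V3 F3"
proof -
  let ?F = "F1 \<union> F2 \<union> F3"
  have in_V: "x \<in> V1" "x \<in> V2" "y \<in> V1" "y \<in> V3" "z \<in> V2" "z \<in> V3"
    "x \<notin> V3" "y \<notin> V2" "z \<notin> V1"
    using g unfolding glued_def by auto
  have *: "F2 \<union> F1 \<union> F3 = ?F" "F3 \<union> F1 \<union> F2 = ?F" "F1 \<union> F3 \<union> F2 = ?F" "F3 \<union> F2 \<union> F1 = ?F" by auto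
  have m: "joined ?F u v" if "joined F1 u v \<or> joined F2 u v \<or> joined F3 u v" for u v
    using that joined_mono[of _ u v ?F] by blast
  have nxy: "\<not> joined ?F x y" and yz: "joined ?F y z"
    and all: "\<And>v. v \<in> V1 \<union> V2 \<union> V3 \<Longrightarrow> joined ?F x v \<or> joined ?F y v"
    using i unfolding isolates_def split_by_def by auto
  have nxz: "\<not> joined ?F x z" using nxy yz joined_trans joined_sym by metis
  have "joined F1 x v \<or> joined F1 y v" if "v \<in> V1" for v
    using all[of v] that glued_exit[OF g that, of x] glued_exit[OF g that, of y] by auto
  then have 1: "split_by V1 x y F1" using nxy m unfolding split_by_def by blast
  \<comment> \<open>The starting point \<open>y\<close> lies outside the second copy, so the last
    premise of \<open>glued_exit\<close> is vacuous for it.\<close>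
  have "joined F2 x v \<or> joined F2 z v" if "v \<in> V2" for v
    using all[of v] that in_V
      glued_exit[OF glued_swap12[OF g] that, of x] glued_exit[OF glued_swap12[OF g] that, of y]
    unfolding * by auto
  then have 2: "split_by V2 x z F2" using nxz m unfolding split_by_def by blast
  have "joined F3 y v \<or> joined F3 z v" if "v \<in> V3" for v
    using all[of v] that in_V
      glued_exit[OF glued_swap12[OF glued_swap23[OF g]] that, of x]
      glued_exit[OF glued_swap12[OF glued_swap23[OF g]] that, of y]
    unfolding * by auto
  \<comment> \<open>Otherwise copies 1 and 3 would both be cut at \<open>y\<close>, against
    \<open>yz\<close>.\<close>
  moreover have "joined F3 y z"
    using glued_two_cuts[OF glued_swap12[OF glued_swap23[OF g]]] 1 yz joined_sym[of F1 y x]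
    unfolding * split_by_def by auto
  ultimately have "edge_connected V3 F3" using joined_trans by (metis edge_connectedI)
  then show ?thesis using 1 2 by blast
qed


section \<open>Recurrences for the probabilities\<close>

text \<open>The four alternatives of \<open>glued_connected_iff\<close> exclude one another, and
  each is a conjunction of events on disjoint edge sets.\<close>

lemma weight_glued_connected:
  assumes g: "glued V1 V2 V3 E1 E2 E3 x y z"
  shows "weight p (E1 \<union> E2 \<union> E3) (edge_connected (V1 \<union> V2 \<union> V3)) =
    weight p E1 (edge_connected V1) * weight p E2 (edge_connected V2) * weight p E3 (edge_connected V3) +
    weight p E1 (split_by V1 x y) * weight p E2 (edge_connected V2) * weight p E3 (edge_connected V3) +
    weight p E1 (edge_connected V1) * weight p E2 (split_by V2 x z) * weight p E3 (edge_connected V3) +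
    weight p E1 (edge_connected V1) * weight p E2 (edge_connected V2) * weight p E3 (split_by V3 y z)"
proof -
  let ?E = "E1 \<union> E2 \<union> E3"
  note E = glued_edges[OF g]
  let ?ev = "\<lambda>P1 P2 P3 F. P1 (F \<inter> E1) \<and> P2 (F \<inter> E2) \<and> P3 (F \<inter> E3)"
  let ?A = "?ev (edge_connected V1) (edge_connected V2) (edge_connected V3)"
  let ?B = "?ev (split_by V1 x y) (edge_connected V2) (edge_connected V3)"
  let ?C = "?ev (edge_connected V1) (split_by V2 x z) (edge_connected V3)"
  let ?D = "?ev (edge_connected V1) (edge_connected V2) (split_by V3 y z)"
  have fin: "finite ?E" using E by simp
  note in_V = glued_joints[OF g]
  have n: "\<not> (edge_connected V1 F \<and> split_by V1 x y F)" "\<not> (edge_connected V2 F \<and> split_by V2 x z F)"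
    "\<not> (edge_connected V3 F \<and> split_by V3 y z F)" for F
    using in_V by (auto simp: edge_connected_iff split_by_def)
  have "weight p ?E (edge_connected (V1 \<union> V2 \<union> V3)) = weight p ?E (\<lambda>F. ?A F \<or> (?B F \<or> (?C F \<or> ?D F)))"
    using glued_connected_iff[OF glued_Int(1)[OF g]] glued_Int(2)[OF g]
    by (intro weight_cong) simp
  also have "\<dots> = weight p ?E ?A + weight p ?E (\<lambda>F. ?B F \<or> (?C F \<or> ?D F))"
    using n by (intro weight_disj[OF fin]) blast
  also have "weight p ?E (\<lambda>F. ?B F \<or> (?C F \<or> ?D F)) = weight p ?E ?B + weight p ?E (\<lambda>F. ?C F \<or> ?D F)"
    using n by (intro weight_disj[OF fin]) blast
  also have "weight p ?E (\<lambda>F. ?C F \<or> ?D F) = weight p ?E ?C + weight p ?E ?D"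
    using n by (intro weight_disj[OF fin]) blast
  finally show ?thesis by (simp add: weight_indep3[OF E])
qed

lemma weight_glued_isolates_corner:
  assumes g: "glued V1 V2 V3 E1 E2 E3 x y z"
    and abc: "a \<in> V1" "b \<in> V2" "c \<in> V3" and p: "0 < p" "p < 1"
  shows "weight p E1 (isolates V1 a x y) *
      (weight p E2 (edge_connected V2) * weight p E3 (edge_connected V3) +
       weight p E2 (split_by V2 x z) * weight p E3 (edge_connected V3) +
       weight p E2 (edge_connected V2) * weight p E3 (split_by V3 y z))
    \<le> weight p (E1 \<union> E2 \<union> E3) (isolates (V1 \<union> V2 \<union> V3) a b c)"
proof -
  let ?E = "E1 \<union> E2 \<union> E3"
  note E = glued_edges[OF g]
  let ?ev = "\<lambda>P2 P3 F. isolates V1 a x y (F \<inter> E1) \<and> P2 (F \<inter> E2) \<and> P3 (F \<inter> E3)"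
  let ?B = "?ev (edge_connected V2) (edge_connected V3)"
  let ?C = "?ev (split_by V2 x z) (edge_connected V3)"
  let ?D = "?ev (edge_connected V2) (split_by V3 y z)"
  have fin: "finite ?E" using E by simp
  note in_V = glued_joints[OF g]
  have n: "\<not> (edge_connected V2 F \<and> split_by V2 x z F)"
    "\<not> (edge_connected V3 F \<and> split_by V3 y z F)" for F
    using in_V by (auto simp: edge_connected_iff split_by_def)
  have "weight p ?E ?B + (weight p ?E ?C + weight p ?E ?D) = weight p ?E ?B + weight p ?E (\<lambda>F. ?C F \<or> ?D F)"
    using n by (subst weight_disj[OF fin]) auto
  also have "\<dots> = weight p ?E (\<lambda>F. ?B F \<or> (?C F \<or> ?D F))"
    using n by (subst weight_disj[OF fin]) auto
  also have "\<dots> \<le> weight p ?E (isolates (V1 \<union> V2 \<union> V3) a b c)"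
  proof (rule weight_mono[OF fin p])
    fix F assume F: "F \<subseteq> ?E" and "?B F \<or> (?C F \<or> ?D F)"
    then have "isolates (V1 \<union> V2 \<union> V3) a b c (F \<inter> E1 \<union> F \<inter> E2 \<union> F \<inter> E3)"
      using glued_isolates_corner[OF glued_Int(1)[OF g F] abc] by blast
    then show "isolates (V1 \<union> V2 \<union> V3) a b c F" by (simp only: glued_Int(2)[OF g F])
  qed
  finally show ?thesis by (simp add: weight_indep3[OF E] algebra_simps)
qed

lemma weight_glued_isolates_joint:
  assumes g: "glued V1 V2 V3 E1 E2 E3 x y z"
    and p: "0 < p" "p < 1"
  shows "weight p (E1 \<union> E2 \<union> E3) (isolates (V1 \<union> V2 \<union> V3) x y z) \<le>
    weight p E1 (split_by V1 x y) * weight p E2 (split_by V2 x z) * weight p E3 (edge_connected V3)"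
proof -
  note E = glued_edges[OF g]
  have "weight p (E1 \<union> E2 \<union> E3) (isolates (V1 \<union> V2 \<union> V3) x y z) \<le> weight p (E1 \<union> E2 \<union> E3)
    (\<lambda>F. split_by V1 x y (F \<inter> E1) \<and> split_by V2 x z (F \<inter> E2) \<and> edge_connected V3 (F \<inter> E3))"
    using E p glued_isolates_joint[OF glued_Int(1)[OF g]] glued_Int(2)[OF g]
    by (intro weight_mono) simp_all
  then show ?thesis by (simp add: weight_indep3[OF E])
qed

text \<open>Reduces the six orderings of three corners to the choice of the isolated one.\<close>

lemma isolates_commute: "isolates V u v w = isolates V u w v"
  unfolding isolates_def split_by_def fun_eq_iff by (meson joined_sym joined_trans)


section \<open>The triangle\<close>

lemma weight_empty: "weight p {} P = (if P {} then 1 else 0)"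
  by (simp add: weight_def cong: conj_cong)

text \<open>Conditioning on the status of \<open>e\<close>. Repeated use lets simplification
  evaluate weights on the triangle.\<close>

lemma weight_insert:
  assumes "finite E" "e \<notin> E"
  shows "weight p (insert e E) P = p * weight p E (\<lambda>F. P (insert e F)) + (1 - p) * weight p E P"
proof -
  let ?w = "\<lambda>A F. \<Prod>e\<in>A. if e \<in> F then p else 1 - p"
  have w: "weight p A Q = (\<Sum>F\<in>Pow A. if Q F then ?w A F else 0)" if "finite A" for A Q
    unfolding weight_def using that sum.inter_filter[of "Pow A" "?w A" Q]
    by (simp add: Pow_def)
  have "inj_on (insert e) (Pow E)"
    using assms(2) by (auto simp: inj_on_def)
  then have "weight p (insert e E) P = (\<Sum>F\<in>Pow E. if P F then ?w (insert e E) F else 0) +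
      (\<Sum>F\<in>Pow E. if P (insert e F) then ?w (insert e E) (insert e F) else 0)"
    using assms by (simp add: w Pow_insert, subst sum.union_disjoint) (auto simp: sum.reindex)
  also have "(\<Sum>F\<in>Pow E. if P F then ?w (insert e E) F else 0) = (1 - p) * weight p E P"
    using assms unfolding w[OF assms(1)] sum_distrib_left by (intro sum.cong) auto
  also have "(\<Sum>F\<in>Pow E. if P (insert e F) then ?w (insert e E) (insert e F) else 0) =
      p * weight p E (\<lambda>F. P (insert e F))"
  proof -
    have "?w E (insert e F) = ?w E F" for F
      using assms(2) by (intro prod.cong) auto
    then show ?thesis
      using assms unfolding w[OF assms(1)] sum_distrib_left by (intro sum.cong) auto
  qed
  finally show ?thesis by simp
qed

lemma joined_triangle:
  assumes d: "distinct [a, b, c]" and F: "F \<subseteq> {{a, b}, {a, c}, {b, c}}"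
  shows "joined F a b \<longleftrightarrow> {a, b} \<in> F \<or> {a, c} \<in> F \<and> {b, c} \<in> F"
proof
  assume j: "joined F a b"
  show "{a, b} \<in> F \<or> {a, c} \<in> F \<and> {b, c} \<in> F"
  proof (rule ccontr)
    assume n: "\<not> ?thesis"
    \<comment> \<open>This set would be the component of \<open>a\<close>: by \<open>n\<close>, no
      edge of \<open>F\<close> leads from it to \<open>b\<close>.\<close>
    have "b \<in> (if {a, c} \<in> F then {a, c} else {a})"
      using j
    proof (rule joined_closed)
      fix k l assume k: "k \<in> (if {a, c} \<in> F then {a, c} else {a})" and e: "{k, l} \<in> F"
      have "{k, l} = {a, b} \<or> {k, l} = {a, c} \<or> {k, l} = {b, c}" using e F by auto
      then show "l \<in> (if {a, c} \<in> F then {a, c} else {a})"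
        using k e n d by (auto simp: doubleton_eq_iff insert_commute split: if_splits)
    qed simp
    then show False using d by (simp split: if_splits)
  qed
next
  assume "{a, b} \<in> F \<or> {a, c} \<in> F \<and> {b, c} \<in> F"
  then show "joined F a b"
    using joined_step[OF joined_refl, of a _ F] joined_step[of F a c b] by (auto simp: insert_commute)
qed

text \<open>The favourable outcomes are those with at least two operational edges.\<close>

lemma weight_triangle_connected:
  assumes d: "distinct [a, b, c]"
  shows "weight p {{a, b}, {a, c}, {b, c}} (edge_connected {a, b, c}) = 3 * p\<^sup>2 * (1 - p) + p ^ 3"
proof -
  let ?E = "{{a, b}, {a, c}, {b, c}}"
  have ne: "a \<noteq> b" "b \<noteq> a" "a \<noteq> c" "c \<noteq> a" "b \<noteq> c" "c \<noteq> b" using d by auto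
  let ?Q = "\<lambda>F. ({a, b} \<in> F \<or> {a, c} \<in> F \<and> {b, c} \<in> F) \<and> ({a, c} \<in> F \<or> {a, b} \<in> F \<and> {b, c} \<in> F)"
  have "weight p ?E (edge_connected {a, b, c}) = weight p ?E ?Q"
  proof (rule weight_cong)
    fix F assume F: "F \<subseteq> ?E"
    have "edge_connected {a, b, c} F \<longleftrightarrow> joined F a b \<and> joined F a c"
    proof
      assume "joined F a b \<and> joined F a c"
      then show "edge_connected {a, b, c} F" by (intro edge_connectedI[of _ _ a]) auto
    qed (simp add: edge_connected_iff)
    then show "edge_connected {a, b, c} F \<longleftrightarrow> ?Q F"
      using joined_triangle[OF d F] joined_triangle[of a c b F] d F by (auto simp: insert_commute)
  qed
  also have "\<dots> = 3 * p\<^sup>2 * (1 - p) + p ^ 3"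
    using ne by (simp add: weight_insert weight_empty doubleton_eq_iff algebra_simps
        power2_eq_square power3_eq_cube)
  finally show ?thesis .
qed

text \<open>The only favourable outcome has \<open>{b, c}\<close> as its single operational
  edge.\<close>

lemma weight_triangle_isolates:
  assumes d: "distinct [a, b, c]"
  shows "weight p {{a, b}, {a, c}, {b, c}} (isolates {a, b, c} a b c) = p * (1 - p)\<^sup>2"
proof -
  let ?E = "{{a, b}, {a, c}, {b, c}}"
  have ne: "a \<noteq> b" "b \<noteq> a" "a \<noteq> c" "c \<noteq> a" "b \<noteq> c" "c \<noteq> b" using d by auto
  let ?Q = "\<lambda>F. \<not> ({a, b} \<in> F \<or> {a, c} \<in> F \<and> {b, c} \<in> F) \<and> ({b, c} \<in> F \<or> {a, b} \<in> F \<and> {a, c} \<in> F)"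
  have "weight p ?E (isolates {a, b, c} a b c) = weight p ?E ?Q"
  proof (rule weight_cong)
    fix F assume F: "F \<subseteq> ?E"
    have "isolates {a, b, c} a b c F \<longleftrightarrow> \<not> joined F a b \<and> joined F b c"
      by (auto simp: isolates_def split_by_def)
    then show "isolates {a, b, c} a b c F \<longleftrightarrow> ?Q F"
      using joined_triangle[OF d F] joined_triangle[of b c a F] d F by (auto simp: insert_commute)
  qed
  also have "\<dots> = p * (1 - p)\<^sup>2"
    using ne by (simp add: weight_insert weight_empty doubleton_eq_iff algebra_simps power2_eq_square)
  finally show ?thesis .
qed

lemma triple_eq_cases:
  assumes "{a, b, c} = {u, v, w}" "card {a, b, c} = 3"
  shows "(u, v, w) \<in> {(a, b, c), (a, c, b), (b, a, c), (b, c, a), (c, a, b), (c, b, a)}"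
proof -
  have "card (set [u, v, w]) = length [u, v, w]" using assms by simp
  then have "distinct [u, v, w]" by (rule card_distinct)
  moreover have "u \<in> {a, b, c}" "v \<in> {a, b, c}" "w \<in> {a, b, c}" unfolding assms(1) by simp_all
  ultimately show ?thesis by auto
qed

lemma weight_triangle_isolates_any:
  assumes d: "distinct [a, b, c]" and "{a, b, c} = {u, v, w}"
  shows "weight p {{a, b}, {a, c}, {b, c}} (isolates {a, b, c} u v w) = p * (1 - p)\<^sup>2"
proof -
  have "card {a, b, c} = 3" using d by simp
  from triple_eq_cases[OF assms(2) this]
  have "distinct [u, v, w] \<and> {{a, b}, {a, c}, {b, c}} = {{u, v}, {u, w}, {v, w}}"
    using d by (elim insertE) (auto simp: insert_commute)
  then show ?thesis using weight_triangle_isolates[of u v w p] assms(2) by simp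
qed


section \<open>The web as three glued copies\<close>

text \<open>Unlike in \<^const>\<open>sierpinski_gasket\<close>, the new corners are the vertices obtained by identification.\<close>

inductive glued_web :: "nat \<Rightarrow> 'a set \<Rightarrow> 'a set set \<Rightarrow> 'a set \<Rightarrow> bool" where
  triangle: "distinct [a, b, c] \<Longrightarrow>
    glued_web 0 {a, b, c} {{a, b}, {a, c}, {b, c}} {a, b, c}"
| step: "glued_web n V1 E1 {a, x, y} \<Longrightarrow>
    glued_web n V2 E2 {b, x, z} \<Longrightarrow>
    glued_web n V3 E3 {c, y, z} \<Longrightarrow>
    V1 \<inter> V2 = {x} \<Longrightarrow> V1 \<inter> V3 = {y} \<Longrightarrow> V2 \<inter> V3 = {z} \<Longrightarrow>
    glued_web (Suc n) (V1 \<union> V2 \<union> V3) (E1 \<union> E2 \<union> E3) {x, y, z}"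

text \<open>Copies sharing a single vertex share no two-element edge, and the joints differ because
  corner sets have three elements.\<close>

lemma gluedI:
  assumes wf: "finite E1" "finite E2" "finite E3"
      "\<forall>e\<in>E1. e \<subseteq> V1 \<and> card e = 2" "\<forall>e\<in>E2. e \<subseteq> V2 \<and> card e = 2" "\<forall>e\<in>E3. e \<subseteq> V3 \<and> card e = 2"
    and card: "card {a, x, y} = 3" "card {b, x, z} = 3" "card {c, y, z} = 3"
    and V: "V1 \<inter> V2 = {x}" "V1 \<inter> V3 = {y}" "V2 \<inter> V3 = {z}"
  shows "glued V1 V2 V3 E1 E2 E3 x y z"
proof -
  have no: "\<not> e \<subseteq> {v}" if "card e = 2" for e and v :: 'a
    using that card_mono[of "{v}" e] by auto
  have "E1 \<inter> E2 = {}" "E1 \<inter> E3 = {}" "E2 \<inter> E3 = {}"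
    using wf no V by (metis disjoint_iff le_inf_iff)+
  moreover have "x \<noteq> y" "x \<noteq> z" "y \<noteq> z"
    using card by (auto simp: card_insert_if split: if_splits)
  moreover have "\<Union>E1 \<subseteq> V1" "\<Union>E2 \<subseteq> V2" "\<Union>E3 \<subseteq> V3"
    using wf by blast+
  ultimately show ?thesis using wf V unfolding glued_def by simp
qed

lemma glued_web_wf:
  assumes "glued_web n V E C"
  shows "finite E \<and> (\<forall>e\<in>E. e \<subseteq> V \<and> card e = 2) \<and> C \<subseteq> V \<and> card C = 3"
  using assms
proof induction
  case (step n V1 E1 a x y V2 E2 b z V3 E3 c)
  have "card {a, x, y} = 3" "card {b, x, z} = 3" "card {c, y, z} = 3"
    using step.IH by blast+
  then have "x \<noteq> y" "x \<noteq> z" "y \<noteq> z"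
    by (auto simp: card_insert_if split: if_splits)
  then show ?case using step.IH by auto
qed auto

text \<open>Adding a vertex over every edge commutes with gluing and keeps the corners, so the step
  can be carried out in each copy. For a single triangle it produces three triangles glued at the
  old vertices.\<close>

lemma glued_web_subdivide:
  assumes "glued_web n V E C" "inj_on new E" "new ` E \<inter> V = {}"
  shows "glued_web (Suc n) (V \<union> new ` E) (E \<union> {{u, new e} | u e. e \<in> E \<and> u \<in> e}) C"
  using assms
proof induction
  case (triangle a b c)
  let ?p = "new {a, b}" and ?q = "new {a, c}" and ?r = "new {b, c}"
  have "?p \<noteq> ?q" "?p \<noteq> ?r" "?q \<noteq> ?r"
    using triangle by (auto simp: inj_on_def doubleton_eq_iff)
  moreover have "?p \<notin> {a, b, c}" "?q \<notin> {a, b, c}" "?r \<notin> {a, b, c}"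
    using triangle.prems(2) unfolding disjoint_iff by simp_all
  ultimately have *: "distinct [?p, a, b]" "distinct [?q, a, c]" "distinct [?r, b, c]"
    "{?p, a, b} \<inter> {?q, a, c} = {a}" "{?p, a, b} \<inter> {?r, b, c} = {b}" "{?q, a, c} \<inter> {?r, b, c} = {c}"
    using triangle(1) by auto
  have new_edges: "{{u, new e} | u e. e \<in> D \<and> u \<in> e} = (\<Union>e\<in>D. (\<lambda>u. {u, new e}) ` e)" for D
    by auto
  have "{a, b, c} \<union> new ` {{a, b}, {a, c}, {b, c}} = {?p, a, b} \<union> {?q, a, c} \<union> {?r, b, c}"
    by auto
  moreover have "{{a, b}, {a, c}, {b, c}} \<union>
        {{u, new e} | u e. e \<in> {{a, b}, {a, c}, {b, c}} \<and> u \<in> e} =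
      {{?p, a}, {?p, b}, {a, b}} \<union> {{?q, a}, {?q, c}, {a, c}} \<union> {{?r, b}, {?r, c}, {b, c}}"
    unfolding new_edges by (simp add: insert_commute)
  ultimately show ?case
    using glued_web.step[OF *(1-3)[THEN glued_web.triangle] *(4-6)] by simp
next
  case (step n V1 E1 a x y V2 E2 b z V3 E3 c)
  let ?N = "\<lambda>E. {{u, new e} | u e. e \<in> E \<and> u \<in> e}"
  note wf = step.hyps(1-3)[THEN glued_web_wf]
  have g: "glued V1 V2 V3 E1 E2 E3 x y z"
    using wf step.hyps(4-6) by (intro gluedI[of _ _ _ _ _ _ a x y b z c]) auto
  have inj: "inj_on new E1" "inj_on new E2" "inj_on new E3"
    using step.prems(1) by (auto intro: inj_on_subset)
  have out: "new ` E1 \<inter> (V1 \<union> V2 \<union> V3) = {}" "new ` E2 \<inter> (V1 \<union> V2 \<union> V3) = {}"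
    "new ` E3 \<inter> (V1 \<union> V2 \<union> V3) = {}"
    using step.prems(2) by auto
  have image_disj: "new ` A \<inter> new ` B = {}"
    if "A \<subseteq> E1 \<union> E2 \<union> E3" "B \<subseteq> E1 \<union> E2 \<union> E3" "A \<inter> B = {}" for A B
    using inj_on_image_Int[OF step.prems(1) that(1,2)] that(3) by simp
  have disj: "new ` E1 \<inter> new ` E2 = {}" "new ` E1 \<inter> new ` E3 = {}" "new ` E2 \<inter> new ` E3 = {}"
    using glued_edges(4-6)[OF g] by (intro image_disj; blast)+
  \<comment> \<open>The new vertices avoid all old ones and differ between copies, so the joints
    remain the only shared vertices.\<close>
  have V: "(V1 \<union> new ` E1) \<inter> (V2 \<union> new ` E2) = {x}"
    "(V1 \<union> new ` E1) \<inter> (V3 \<union> new ` E3) = {y}"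
    "(V2 \<union> new ` E2) \<inter> (V3 \<union> new ` E3) = {z}"
    using out disj step.hyps(4-6) by (simp_all add: Int_Un_distrib Int_Un_distrib2 Int_commute)
  have "new ` E1 \<inter> V1 = {}" "new ` E2 \<inter> V2 = {}" "new ` E3 \<inter> V3 = {}"
    using out by auto
  note W = step.IH(1)[OF inj(1) this(1)] step.IH(2)[OF inj(2) this(2)] step.IH(3)[OF inj(3) this(3)]
  have "glued_web (Suc (Suc n))
      ((V1 \<union> new ` E1) \<union> (V2 \<union> new ` E2) \<union> (V3 \<union> new ` E3))
      ((E1 \<union> ?N E1) \<union> (E2 \<union> ?N E2) \<union> (E3 \<union> ?N E3)) {x, y, z}"
    by (rule glued_web.step[OF W V])
  moreover have "(V1 \<union> new ` E1) \<union> (V2 \<union> new ` E2) \<union> (V3 \<union> new ` E3) =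
      V1 \<union> V2 \<union> V3 \<union> new ` (E1 \<union> E2 \<union> E3)" by blast
  moreover have "(E1 \<union> ?N E1) \<union> (E2 \<union> ?N E2) \<union> (E3 \<union> ?N E3) = E1 \<union> E2 \<union> E3 \<union> ?N (E1 \<union> E2 \<union> E3)"
    by blast
  ultimately show ?case by simp
qed

lemma pseudofractal_web_glued:
  assumes "pseudofractal_web n V E"
  shows "\<exists>C. glued_web n V E C"
  using assms
proof induction
  case (triangle a b c)
  from glued_web.triangle[OF this] show ?case by blast
next
  case (step n V E new)
  then show ?case using glued_web_subdivide by blast
qed


section \<open>Comparison\<close>

text \<open>Separating sequences: the web stays below them and the gasket above, so each family
  needs only one-sided bounds.\<close>

fun web_rel :: "real \<Rightarrow> nat \<Rightarrow> real" and web_iso :: "real \<Rightarrow> nat \<Rightarrow> real" where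
  "web_rel p 0 = 3 * p\<^sup>2 * (1 - p) + p ^ 3"
| "web_rel p (Suc n) = web_rel p n ^ 3 + 6 * (web_rel p n)\<^sup>2 * web_iso p n"
| "web_iso p 0 = p * (1 - p)\<^sup>2"
| "web_iso p (Suc n) = 4 * web_rel p n * (web_iso p n)\<^sup>2"

lemma web_rel_iso_pos:
  assumes "0 < p" "p < 1"
  shows "0 < web_rel p n \<and> 0 < web_iso p n"
  by (induction n) (use assms in \<open>auto intro!: add_pos_pos\<close>)

lemma mult3_mono:
  fixes a b c :: real
  assumes "0 \<le> a" "a \<le> a'" "0 \<le> b" "b \<le> b'" "0 \<le> c" "c \<le> c'"
  shows "a * b * c \<le> a' * b' * c'"
  using assms by (intro mult_mono mult_nonneg_nonneg) auto

text \<open>Induction along the gluing, with recurrences monotone in nonnegative arguments. All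
  orderings of the corners are covered because each corner of a copy may be the isolated
  one.\<close>

lemma glued_web_le:
  assumes p: "0 < p" "p < 1" and "glued_web n V E C"
  shows "weight p E (edge_connected V) \<le> web_rel p n \<and>
    (\<forall>u v w. C = {u, v, w} \<longrightarrow> weight p E (isolates V u v w) \<le> web_iso p n)"
  using assms(3)
proof induction
  case (triangle a b c)
  have "weight p {{a, b}, {a, c}, {b, c}} (isolates {a, b, c} u v w) = web_iso p 0"
    if "{a, b, c} = {u, v, w}" for u v w
    using weight_triangle_isolates_any[OF triangle that] by simp
  moreover have "weight p {{a, b}, {a, c}, {b, c}} (edge_connected {a, b, c}) = web_rel p 0"
    using weight_triangle_connected[OF triangle] by simp
  ultimately show ?case by (metis order_refl less_nat_zero_code)
next
  case (step n V1 E1 a x y V2 E2 b z V3 E3 c)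
  let ?r = "web_rel p n" and ?i = "web_iso p n"
  let ?V = "V1 \<union> V2 \<union> V3" and ?E = "E1 \<union> E2 \<union> E3"
  note wf = step.hyps(1-3)[THEN glued_web_wf]
  have g: "glued V1 V2 V3 E1 E2 E3 x y z"
    using wf step.hyps(4-6) by (intro gluedI[of _ _ _ _ _ _ a x y b z c]) auto
  have pos: "0 < ?r" "0 < ?i" using web_rel_iso_pos[OF p] by auto
  note nn = weight_nonneg[OF p]
  have R: "weight p E1 (edge_connected V1) \<le> ?r" "weight p E2 (edge_connected V2) \<le> ?r"
    "weight p E3 (edge_connected V3) \<le> ?r"
    using step.IH by auto
  have "weight p E1 (isolates V1 x y a) \<le> ?i" "weight p E1 (isolates V1 y x a) \<le> ?i"
    "weight p E2 (isolates V2 x z b) \<le> ?i" "weight p E2 (isolates V2 z x b) \<le> ?i"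
    "weight p E3 (isolates V3 y z c) \<le> ?i" "weight p E3 (isolates V3 z y c) \<le> ?i"
    using step.IH by (auto simp: insert_commute)
  \<comment> \<open>Both orders of the joints are recorded, since relabelling the ring reverses some
    of them.\<close>
  then have S: "weight p E1 (split_by V1 x y) \<le> 2 * ?i" "weight p E2 (split_by V2 x z) \<le> 2 * ?i"
    "weight p E3 (split_by V3 y z) \<le> 2 * ?i" "weight p E1 (split_by V1 y x) \<le> 2 * ?i"
    "weight p E2 (split_by V2 z x) \<le> 2 * ?i" "weight p E3 (split_by V3 z y) \<le> 2 * ?i"
    using wf by (auto simp: weight_split_by[where a = a] weight_split_by[where a = b]
        weight_split_by[where a = c])
  have "weight p ?E (edge_connected ?V) \<le>
      ?r * ?r * ?r + 2 * ?i * ?r * ?r + ?r * (2 * ?i) * ?r + ?r * ?r * (2 * ?i)"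
    unfolding weight_glued_connected[OF g] by (intro add_mono mult3_mono nn R S)
  also have "\<dots> = web_rel p (Suc n)"
    by (simp add: power2_eq_square power3_eq_cube)
  finally have 1: "weight p ?E (edge_connected ?V) \<le> web_rel p (Suc n)" .
  have *: "V1 \<union> V3 \<union> V2 = ?V" "E1 \<union> E3 \<union> E2 = ?E" "V2 \<union> V3 \<union> V1 = ?V" "E2 \<union> E3 \<union> E1 = ?E"
    by auto
  have i4: "2 * ?i * (2 * ?i) * ?r = web_iso p (Suc n)"
    by (simp add: power2_eq_square)
  have "weight p ?E (isolates ?V x y z) \<le> 2 * ?i * (2 * ?i) * ?r"
    by (rule order_trans[OF weight_glued_isolates_joint[OF g p]]) (intro mult3_mono nn R S)
  moreover have "weight p ?E (isolates ?V y x z) \<le> 2 * ?i * (2 * ?i) * ?r"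
    by (rule order_trans[OF weight_glued_isolates_joint[OF glued_swap23[OF g] p, unfolded *]])
      (intro mult3_mono nn R S)
  moreover have "weight p ?E (isolates ?V z x y) \<le> 2 * ?i * (2 * ?i) * ?r"
    by (rule order_trans[OF weight_glued_isolates_joint[OF glued_swap23[OF glued_swap12[OF g]] p, unfolded *]])
      (intro mult3_mono nn R S)
  ultimately have I: "weight p ?E (isolates ?V x y z) \<le> web_iso p (Suc n)"
    "weight p ?E (isolates ?V y x z) \<le> web_iso p (Suc n)"
    "weight p ?E (isolates ?V z x y) \<le> web_iso p (Suc n)"
    unfolding i4 by auto
  have "weight p ?E (isolates ?V u v w) \<le> web_iso p (Suc n)" if "{x, y, z} = {u, v, w}" for u v w
  proof -
    have "card {x, y, z} = 3" using g unfolding glued_def by simp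
    then have "(u, v, w) \<in> {(x, y, z), (x, z, y), (y, x, z), (y, z, x), (z, x, y), (z, y, x)}"
      using triple_eq_cases that by metis
    then show ?thesis using I isolates_commute[of ?V] by auto
  qed
  then show ?case using 1 by blast
qed

text \<open>Strictness first enters through \<open>isolates\<close>, at stage 1, and reaches
  \<open>edge_connected\<close> one stage later through \<open>split_by\<close>; hence the two
  thresholds.\<close>

lemma gasket_ge:
  assumes p: "0 < p" "p < 1" and "sierpinski_gasket n V E C"
  shows "web_rel p n \<le> weight p E (edge_connected V) \<and>
    (1 < n \<longrightarrow> web_rel p n < weight p E (edge_connected V)) \<and>
    (\<forall>u v w. C = {u, v, w} \<longrightarrow> web_iso p n \<le> weight p E (isolates V u v w) \<and>
      (0 < n \<longrightarrow> web_iso p n < weight p E (isolates V u v w)))"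
  using assms(3)
proof induction
  case (triangle a b c)
  have "weight p {{a, b}, {a, c}, {b, c}} (isolates {a, b, c} u v w) = web_iso p 0"
    if "{a, b, c} = {u, v, w}" for u v w
    using weight_triangle_isolates_any[OF triangle that] by simp
  moreover have "weight p {{a, b}, {a, c}, {b, c}} (edge_connected {a, b, c}) = web_rel p 0"
    using weight_triangle_connected[OF triangle] by simp
  ultimately show ?case by (metis order_refl less_nat_zero_code)
next
  case (step n V1 E1 a x y V2 E2 b z V3 E3 c)
  let ?r = "web_rel p n" and ?i = "web_iso p n"
  let ?V = "V1 \<union> V2 \<union> V3" and ?E = "E1 \<union> E2 \<union> E3"
  note wf = step.hyps(1-3)[THEN gasket_wf] step.hyps(1-3)[THEN card_gasket_corners]
  have g: "glued V1 V2 V3 E1 E2 E3 x y z"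
    using wf step.hyps(4-6) by (intro gluedI[of _ _ _ _ _ _ a x y b z c]) auto
  have pos: "0 < ?r" "0 < ?i" using web_rel_iso_pos[OF p] by auto
  then have nn: "0 \<le> ?r" "0 \<le> ?i" "0 \<le> 2 * ?i" by auto
  have abc: "a \<in> V1" "b \<in> V2" "c \<in> V3" using wf by auto
  have R: "?r \<le> weight p E1 (edge_connected V1)" "?r \<le> weight p E2 (edge_connected V2)"
    "?r \<le> weight p E3 (edge_connected V3)"
    using step.IH by auto
  have I: "?i \<le> weight p E1 (isolates V1 a x y)" "?i \<le> weight p E2 (isolates V2 b x z)"
    "?i \<le> weight p E3 (isolates V3 c y z)"
    using step.IH by auto
  have "?i \<le> weight p E1 (isolates V1 x y a)" "?i \<le> weight p E1 (isolates V1 y x a)"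
    "?i \<le> weight p E2 (isolates V2 x z b)" "?i \<le> weight p E2 (isolates V2 z x b)"
    "?i \<le> weight p E3 (isolates V3 y z c)" "?i \<le> weight p E3 (isolates V3 z y c)"
    using step.IH by (auto simp: insert_commute)
  then have S: "2 * ?i \<le> weight p E1 (split_by V1 x y)" "2 * ?i \<le> weight p E2 (split_by V2 x z)"
    "2 * ?i \<le> weight p E3 (split_by V3 y z)" "2 * ?i \<le> weight p E1 (split_by V1 y x)"
    "2 * ?i \<le> weight p E2 (split_by V2 z x)" "2 * ?i \<le> weight p E3 (split_by V3 z y)"
    using wf by (auto simp: weight_split_by[where a = a] weight_split_by[where a = b]
        weight_split_by[where a = c])
  have r_Suc: "web_rel p (Suc n) = ?r * ?r * ?r + 2 * ?i * ?r * ?r + ?r * (2 * ?i) * ?r + ?r * ?r * (2 * ?i)"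
    by (simp add: power2_eq_square power3_eq_cube)
  have 1: "web_rel p (Suc n) \<le> weight p ?E (edge_connected ?V)"
    unfolding weight_glued_connected[OF g] r_Suc by (intro add_mono mult3_mono nn R S)
  have 2: "web_rel p (Suc n) < weight p ?E (edge_connected ?V)" if "1 < Suc n"
  proof -
    \<comment> \<open>The copies now have stage \<open>n > 0\<close>, where the isolation bound is
      strict; one strict summand suffices.\<close>
    have "?i < weight p E1 (isolates V1 x y a)" "?i < weight p E1 (isolates V1 y x a)"
      using step.IH(1) that by (auto simp: insert_commute)
    then have "2 * ?i < weight p E1 (split_by V1 x y)"
      using wf by (auto simp: weight_split_by[where a = a])
    then have "2 * ?i * ?r * ?r < weight p E1 (split_by V1 x y) * ?r * ?r"
      using pos by simp
    also have "\<dots> \<le> weight p E1 (split_by V1 x y) * weight p E2 (edge_connected V2) * weight p E3 (edge_connected V3)"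
      by (intro mult3_mono nn R order_refl weight_nonneg[OF p])
    finally have S1: "2 * ?i * ?r * ?r <
      weight p E1 (split_by V1 x y) * weight p E2 (edge_connected V2) * weight p E3 (edge_connected V3)" .
    show ?thesis
      unfolding weight_glued_connected[OF g] r_Suc
      by (rule add_less_le_mono[OF add_less_le_mono[OF add_le_less_mono[OF _ S1]]])
        (rule mult3_mono; rule nn R S)+
  qed
  \<comment> \<open>The gap is \<open>?i * ?r * ?r\<close>, the case in which neither of the other
    two copies splits.\<close>
  have i_Suc: "web_iso p (Suc n) < ?i * (q + s + t)"
    if "?r * ?r \<le> q" "2 * ?i * ?r \<le> s" "?r * (2 * ?i) \<le> t" for q s t
  proof -
    have "web_iso p (Suc n) < ?i * (?r * ?r + 2 * ?i * ?r + ?r * (2 * ?i))"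
      using pos by (simp add: power2_eq_square algebra_simps)
    also have "\<dots> \<le> ?i * (q + s + t)"
      using that pos by (intro mult_left_mono add_mono) auto
    finally show ?thesis .
  qed
  \<comment> \<open>One estimate for all three choices of the isolated corner: \<open>w\<close>
    belongs to its own copy, the other variables to the remaining two copies.\<close>
  have iso: "web_iso p (Suc n) < weight p ?E P"
    if "?i \<le> w" "?r \<le> R2" "?r \<le> R3" "2 * ?i \<le> S2" "2 * ?i \<le> S3"
      "w * (R2 * R3 + S2 * R3 + R2 * S3) \<le> weight p ?E P" for w R2 R3 S2 S3 P
  proof -
    have "web_iso p (Suc n) < ?i * (R2 * R3 + S2 * R3 + R2 * S3)"
      using that nn by (intro i_Suc mult_mono) auto
    also have "\<dots> \<le> w * (R2 * R3 + S2 * R3 + R2 * S3)"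
      using that nn by (intro mult_right_mono add_nonneg_nonneg mult_nonneg_nonneg) auto
    finally show ?thesis using that by simp
  qed
  have *: "V2 \<union> V1 \<union> V3 = ?V" "E2 \<union> E1 \<union> E3 = ?E" "V3 \<union> V1 \<union> V2 = ?V" "E3 \<union> E1 \<union> E2 = ?E"
    by auto
  have "web_iso p (Suc n) < weight p ?E (isolates ?V a b c)"
    by (rule iso[OF I(1) R(2,3) S(2,3) weight_glued_isolates_corner[OF g abc p]])
  moreover have "web_iso p (Suc n) < weight p ?E (isolates ?V b a c)"
    by (rule iso[OF I(2) R(1,3) S(1,6)
          weight_glued_isolates_corner[OF glued_swap12[OF g] abc(2,1,3) p, unfolded *]])
  moreover have "web_iso p (Suc n) < weight p ?E (isolates ?V c a b)"
    by (rule iso[OF I(3) R(1,2) S(4,5)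
          weight_glued_isolates_corner[OF glued_swap12[OF glued_swap23[OF g]] abc(3,1,2) p, unfolded *]])
  ultimately have J: "web_iso p (Suc n) < weight p ?E (isolates ?V a b c)"
    "web_iso p (Suc n) < weight p ?E (isolates ?V b a c)"
    "web_iso p (Suc n) < weight p ?E (isolates ?V c a b)"
    by auto
  have "web_iso p (Suc n) < weight p ?E (isolates ?V u v w)" if "{a, b, c} = {u, v, w}" for u v w
  proof -
    have "card {a, b, c} = 3"
      using card_gasket_corners[OF sierpinski_gasket.step[OF step.hyps]] by simp
    then have "(u, v, w) \<in> {(a, b, c), (a, c, b), (b, a, c), (b, c, a), (c, a, b), (c, b, a)}"
      using triple_eq_cases that by metis
    then show ?thesis using J isolates_commute[of ?V] by auto
  qed
  then show ?case using 1 2 by (auto intro: less_imp_le)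
qed

theorem mainTheorem3:
  fixes p :: real and n :: nat
    and V :: "'a set" and E :: "'a set set"
    and Vs :: "'b set" and Es :: "'b set set" and C :: "'b set"
  assumes "0 < p" and "p < 1"
    and "n > 1"
    and "pseudofractal_web n V E"
    and "sierpinski_gasket n Vs Es C"
  shows "reliability Vs Es p > reliability V E p"
proof -
  obtain C' where "glued_web n V E C'"
    using pseudofractal_web_glued[OF assms(4)] by blast
  then have "weight p E (edge_connected V) \<le> web_rel p n"
    using glued_web_le[OF assms(1,2)] by blast
  also have "\<dots> < weight p Es (edge_connected Vs)"
    using gasket_ge[OF assms(1,2,5)] assms(3) by blast
  finally show ?thesis
    using web_wf[OF assms(4)] gasket_wf[OF assms(5)] assms(1,2)
    by (simp add: reliability_def prob_Pi_bernoulli_eq_weight)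
qed

end
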